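(* Let $n\ge 3$ and let $p,p'$ be integers with $2\le p\le n-1$ and $p+p'=n+1$. For $1\le q\le n-1$ let $C_q=(n,1,\ldots,q-1,n-1,q,\ldots,n-2)\in\mathfrak{S}_n$, and for $g\ge 0$ let $N_{q}(g)$ be the number of $n$-cycles $\sigma\in\mathfrak{S}_n$ with $\sigma^{-1}(n)=n-1$ such that $\sigma C_q$ has exactly $n-2g$ cycles (the number of $(q,n-1,n)$-dipoles on the orientable surface of genus $g$). Then $N_p(g)=N_{p'}(g)$ for every $g\ge 0$.
   Context: Combinatorial meaning: a dipole is a 2-cell embedding in an orientable surface of a loopless graph with exactly two vertices, rooted at a vertex and an edge (labelled $n$), with a second distinguished edge (labelled $n-1$), the other edges labelled canonically. $C_q$ is the counterclockwise rotation at the root vertex (root jump, i.e. one plus the number of edges strictly between the root edge and the distinguished edge counterclockwise around the root vertex, equal to $q$) and $\sigma$ the rotation at the non-root vertex (non-root jump $n-1$); faces correspond to cycles of $\sigma C_q$, and a dipole with $n$ edges and $m$ faces lies on the orientable surface of genus $\frac12(n-m)$. *)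

theory Defs
  imports "HOL-Combinatorics.Combinatorics"
begin

text \<open>The symmetric group on \<open>n\<close> letters consists of the functions \<open>\<sigma> :: nat \<Rightarrow> nat\<close> with
  \<open>\<sigma> permutes {1..n}\<close> (identity outside \<open>{1..n}\<close>).\<close>

text \<open>\<open>(n, 1, \<dots>, q-1, n-1, q, \<dots>, n-2)\<close>; for \<open>1 \<le> q \<le> n - 1\<close> every letter of \<open>{1..n}\<close> occurs
  exactly once in the list. \<^const>\<open>cycle_of_list\<close> sends each entry to its right neighbour.\<close>

definition root_rotation :: "nat \<Rightarrow> nat \<Rightarrow> nat \<Rightarrow> nat" where
  "root_rotation n q = cycle_of_list ([n] @ [1..<q] @ [n - 1] @ [q..<n - 1])"

text \<open>Fixed points count as cycles.\<close>

definition num_cycles :: "nat \<Rightarrow> (nat \<Rightarrow> nat) \<Rightarrow> nat" where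
  "num_cycles n f = card (orbit f ` {1..n})"

text \<open>The condition on the number of cycles is stated over the integers, so that it is
  unsatisfiable for \<open>2 * g \<ge> n\<close>.\<close>

definition dipole_perms :: "nat \<Rightarrow> nat \<Rightarrow> nat \<Rightarrow> (nat \<Rightarrow> nat) set" where
  "dipole_perms n q g =
     {\<sigma>. \<sigma> permutes {1..n} \<and> cyclic_on \<sigma> {1..n} \<and> inv \<sigma> n = n - 1 \<and>
         int (num_cycles n (\<sigma> \<circ> root_rotation n q)) = int n - 2 * int g}"

definition num_dipoles :: "nat \<Rightarrow> nat \<Rightarrow> nat \<Rightarrow> nat" where
  "num_dipoles n q g = card (dipole_perms n q g)"

end

theory Submission
  imports Defs
begin

text \<open>Let \<open>\<tau> = (n-1 n)\<close>. The condition \<open>\<sigma>(n-1) = n\<close> says that \<open>\<rho> = \<sigma>\<tau>\<close> is an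
  \<open>(n-1)\<close>-cycle fixing \<open>n\<close>, while \<open>\<tau> C\<^sub>q = (n 1 \<dots> q-1) (q \<dots> n-1)\<close>. Since
  \<open>\<sigma> C\<^sub>q = \<rho> (\<tau> C\<^sub>q)\<close> and \<open>n\<close> is not alone in its cycle, erasing \<open>n\<close> does not change
  the number of cycles. Hence \<open>N\<^sub>q(g)\<close> counts the \<open>(n-1)\<close>-cycles \<open>\<rho>\<close> such that
  \<open>\<rho> (1 \<dots> q-1) (q \<dots> n-1)\<close> has \<open>n - 2g\<close> cycles, and this depends only on the cycle type
  \<open>{q-1, n-q}\<close>, which is invariant under \<open>q \<mapsto> n + 1 - q\<close>.\<close>

section \<open>Erasing a point from its cycle\<close>

text \<open>\<open>g\<close> contracts the two steps x -> a -> f a into one, so it walks along the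
  same orbit and skips \<open>a\<close>. As \<open>f a \<noteq> a\<close>, a single skip always
  suffices.\<close>

lemma orbit_erase:
  assumes erase: "\<And>x. x \<noteq> a \<Longrightarrow> x \<in> S \<Longrightarrow> g x = (if f x = a then f a else f x)"
    and closed: "\<And>x. x \<in> S \<Longrightarrow> f x \<in> S"
    and "f a \<noteq> a" and "x \<in> S" and "x \<noteq> a"
  shows "orbit g x = orbit f x - {a}"
proof (intro set_eqI iffI)
  fix y
  assume "y \<in> orbit g x"
  then have "y \<in> S \<and> y \<in> orbit f x - {a}"
  proof induction
    case base
    show ?case
      using assms erase[of x] by (auto intro: orbit.intros dest: orbit.step[of _ f x])
  next
    case (step y)
    then have "f y \<in> orbit f x"
      by (auto intro: orbit.step)
    then have "f y = a \<Longrightarrow> f a \<in> orbit f x"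
      by (metis orbit.step)
    with \<open>f y \<in> orbit f x\<close> show ?case
      using step assms erase[of y] closed[of y] closed[of a] by auto
  qed
  then show "y \<in> orbit f x - {a}" by simp
next
  fix y
  assume y: "y \<in> orbit f x - {a}"
  then have "y \<in> orbit f x" by simp
  \<comment> \<open>Invariant: whenever the \<open>f\<close>-walk rests at \<open>a\<close>, the
    \<open>g\<close>-walk has already moved on to \<open>f a\<close>.\<close>
  then have "y \<in> S \<and> (if y = a then f a else y) \<in> orbit g x"
  proof induction
    case base
    show ?case
      using assms erase[of x] orbit.base[of g x] by auto
  next
    case (step y)
    then show ?case
      using assms erase[of y] orbit.step[of y g x] by (auto split: if_splits)
  qed
  with y show "y \<in> orbit g x" by auto
qed

text \<open>No orbit is lost, since the orbit of \<open>a\<close> also contains \<open>f a\<close>,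
  a point of \<open>S\<close>. No two are merged, since each orbit keeps a point of \<open>S\<close>
  and orbits of a permutation sharing a point coincide.\<close>

lemma card_orbits_erase:
  assumes erase: "\<And>x. x \<in> S \<Longrightarrow> g x = (if f x = a then f a else f x)"
    and f: "f permutes insert a S" and "finite S" and "a \<notin> S" and "f a \<noteq> a"
  shows "card (orbit g ` S) = card (orbit f ` insert a S)"
proof -
  have closed: "f x \<in> insert a S" if "x \<in> insert a S" for x
    using f that by (simp only: permutes_in_image)
  have perm: "permutation f"
    using f \<open>finite S\<close> permutation_permutes by blast
  have orbit_g: "orbit g x = orbit f x - {a}" if "x \<in> S" for x
    using that assms closed by (intro orbit_erase[where S = "insert a S"]) auto
  have "f a \<in> S"
    using closed[of a] \<open>f a \<noteq> a\<close> by auto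
  moreover have "orbit f a = orbit f (f a)"
    using permutation_orbit_step[OF perm, of a] by simp
  ultimately have "orbit f ` insert a S = orbit f ` S"
    by auto
  moreover have "inj_on (\<lambda>X. X - {a}) (orbit f ` S)"
  proof (rule inj_onI)
    fix X Y
    assume "X \<in> orbit f ` S" "Y \<in> orbit f ` S" and eq: "X - {a} = Y - {a}"
    then obtain x y where x: "x \<in> S" "X = orbit f x" and y: "y \<in> S" "Y = orbit f y"
      by blast
    have "x \<in> orbit f x"
      using perm by (rule permutation_self_in_orbit)
    with x y eq \<open>a \<notin> S\<close> have "x \<in> orbit f y" by auto
    then have "orbit f x = orbit f y"
      using cyclic_on_orbit'[OF perm, of y] by (simp add: cyclic_on_alldef)
    with x y show "X = Y" by simp
  qed
  moreover have "orbit g ` S = (\<lambda>X. X - {a}) ` orbit f ` S"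
    using orbit_g by (force simp: image_image)
  ultimately show ?thesis
    by (simp add: card_image)
qed

text \<open>Cyclicity can be tested at the single point \<open>f a\<close> of \<open>S\<close>: its
  \<open>f\<close>-orbit contains \<open>a\<close>, and its \<open>g\<close>-orbit is the same set
  without \<open>a\<close>.\<close>

lemma cyclic_on_erase_iff:
  assumes erase: "\<And>x. x \<in> S \<Longrightarrow> g x = (if f x = a then f a else f x)"
    and f: "f permutes insert a S" and "finite S" and "a \<notin> S" and "f a \<noteq> a"
  shows "cyclic_on g S \<longleftrightarrow> cyclic_on f (insert a S)"
proof -
  have closed: "f x \<in> insert a S" if "x \<in> insert a S" for x
    using f that by (simp only: permutes_in_image)
  have orbit_g: "orbit g x = orbit f x - {a}" if "x \<in> S" for x
    using that assms closed by (intro orbit_erase[where S = "insert a S"]) auto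
  have perm: "permutation f"
    using f \<open>finite S\<close> permutation_permutes by blast
  have "f a \<in> S"
    using closed[of a] \<open>f a \<noteq> a\<close> by auto
  have orbit_a: "orbit f a = orbit f (f a)" and "a \<in> orbit f a"
    using permutation_orbit_step[OF perm, of a] permutation_self_in_orbit[OF perm, of a] by auto
  show ?thesis
  proof
    assume "cyclic_on g S"
    then have "S = orbit g (f a)"
      using \<open>f a \<in> S\<close> by (simp add: cyclic_on_alldef)
    then have "insert a S = orbit f a"
      using orbit_g[OF \<open>f a \<in> S\<close>] orbit_a \<open>a \<in> orbit f a\<close> by auto
    then show "cyclic_on f (insert a S)"
      by (intro cyclic_on_singleI[of a]) auto
  next
    assume "cyclic_on f (insert a S)"
    then have "insert a S = orbit f (f a)"
      using orbit_a by (simp add: cyclic_on_alldef)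
    then have "S = orbit g (f a)"
      using orbit_g[OF \<open>f a \<in> S\<close>] \<open>a \<notin> S\<close> by auto
    then show "cyclic_on g S"
      using \<open>f a \<in> S\<close> by (intro cyclic_on_singleI) auto
  qed
qed

text \<open>Used below to transport orbits along a relabelling of the letters.\<close>

lemma orbit_semiconj:
  assumes "\<And>x. h (f x) = g (h x)"
  shows "orbit g (h x) = h ` orbit f x"
proof (intro set_eqI iffI)
  fix y
  assume "y \<in> orbit g (h x)"
  then show "y \<in> h ` orbit f x"
    by induction (auto simp: assms[symmetric] intro: orbit.intros)
next
  fix y
  assume "y \<in> h ` orbit f x"
  then obtain z where "z \<in> orbit f x" "y = h z" by blast
  from this(1) have "h z \<in> orbit g (h x)"
    by induction (auto simp: assms intro: orbit.intros)
  with \<open>y = h z\<close> show "y \<in> orbit g (h x)" by simp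
qed

section \<open>Products of a long cycle with a permutation with two cycles\<close>

text \<open>The permutation \<open>(1 \<dots> a) (a+1 \<dots> N)\<close>; meaningful only for \<open>1 \<le> a < N\<close>.\<close>

definition two_cycles :: "nat \<Rightarrow> nat \<Rightarrow> nat \<Rightarrow> nat" where
  "two_cycles N a x =
     (if x \<notin> {1..N} then x else if x = a then 1 else if x = N then a + 1 else x + 1)"

text \<open>For \<open>a \<le> N\<close> this is the cyclic shift of 1..N by N - a: the block 1..a
  moves behind the block a+1..N, and the order inside each block is kept.\<close>

definition swap_blocks :: "nat \<Rightarrow> nat \<Rightarrow> nat \<Rightarrow> nat" where
  "swap_blocks N a x = (if x \<notin> {1..N} then x else if x \<le> a then x + (N - a) else x - a)"

lemma swap_blocks_inverse:
  assumes "a \<le> N"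
  shows "swap_blocks N (N - a) (swap_blocks N a x) = x"
  using assms by (auto simp: swap_blocks_def)

text \<open>Each cycle is carried onto the cycle of its image block; the block of length N - a now
  comes first, which moves the split point.\<close>

lemma swap_blocks_two_cycles:
  assumes "1 \<le> a" and "a < N"
  shows "swap_blocks N a (two_cycles N a x) = two_cycles N (N - a) (swap_blocks N a x)"
  using assms by (auto simp: swap_blocks_def two_cycles_def)

lemma swap_blocks_permutes:
  assumes "a \<le> N"
  shows "swap_blocks N a permutes {1..N}"
proof (rule bij_imp_permutes)
  show "bij_betw (swap_blocks N a) {1..N} {1..N}"
    using swap_blocks_inverse[OF assms] swap_blocks_inverse[of "N - a" N] assms
    by (intro bij_betw_byWitness[where f' = "swap_blocks N (N - a)"])
      (auto simp: swap_blocks_def)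
qed (auto simp: swap_blocks_def)

text \<open>\<open>m\<close> is an integer so that n - 2g can be inserted without truncation at
  0.\<close>

definition long_cycle_factors :: "nat \<Rightarrow> nat \<Rightarrow> int \<Rightarrow> (nat \<Rightarrow> nat) set" where
  "long_cycle_factors N a m =
     {\<rho>. \<rho> permutes {1..N} \<and> cyclic_on \<rho> {1..N} \<and>
         int (card (orbit (\<rho> \<circ> two_cycles N a) ` {1..N})) = m}"

lemma finite_long_cycle_factors: "finite (long_cycle_factors N a m)"
  by (rule finite_subset[OF _ finite_permutations[of "{1..N}"]])
    (auto simp: long_cycle_factors_def)

text \<open>Conjugation by the block swap is injective, keeps long cycles long and preserves the
  number of orbits of the product. An inequality is enough, as exchanging a and N - a gives its
  converse.\<close>

lemma card_long_cycle_factors_le: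
  assumes "1 \<le> a" and "a < N"
  shows "card (long_cycle_factors N a m) \<le> card (long_cycle_factors N (N - a) m)"
proof (rule card_inj_on_le)
  let ?h = "swap_blocks N a" and ?h' = "swap_blocks N (N - a)"
  let ?conj = "\<lambda>\<rho>. ?h \<circ> \<rho> \<circ> ?h'"
  have h'h: "?h' (?h x) = x" for x
    using assms by (simp add: swap_blocks_inverse)
  have hh': "?h (?h' x) = x" for x
    using assms swap_blocks_inverse[of "N - a" N x] by simp
  have perms: "?h permutes {1..N}" "?h' permutes {1..N}"
    using assms by (intro swap_blocks_permutes; simp)+
  show "inj_on ?conj (long_cycle_factors N a m)"
  proof (rule inj_onI)
    fix \<rho> \<rho>'
    assume "?conj \<rho> = ?conj \<rho>'"
    then have "?h' (?conj \<rho> (?h x)) = ?h' (?conj \<rho>' (?h x))" for x by simp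
    then show "\<rho> = \<rho>'" by (simp add: h'h fun_eq_iff)
  qed
  show "?conj ` long_cycle_factors N a m \<subseteq> long_cycle_factors N (N - a) m"
  proof (rule image_subsetI)
    fix \<rho>
    assume "\<rho> \<in> long_cycle_factors N a m"
    then have \<rho>: "\<rho> permutes {1..N}" "cyclic_on \<rho> {1..N}"
      and m: "int (card (orbit (\<rho> \<circ> two_cycles N a) ` {1..N})) = m"
      by (auto simp: long_cycle_factors_def)
    have "?conj \<rho> permutes {1..N}"
      using perms \<rho>(1) by (intro permutes_compose)
    moreover have "cyclic_on (?conj \<rho>) (?h ` {1..N})"
      using \<rho>(2) by (rule cyclic_on_image) (simp add: h'h)
    then have "cyclic_on (?conj \<rho>) {1..N}"
      by (simp only: permutes_image[OF perms(1)])
    moreover have "card (orbit (?conj \<rho> \<circ> two_cycles N (N - a)) ` {1..N})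
        = card (orbit (\<rho> \<circ> two_cycles N a) ` {1..N})"
    proof -
      \<comment> \<open>The inner \<open>?h'\<close> and \<open>?h\<close> cancel, so the new
        product is the \<open>?h\<close>-conjugate of the old one.\<close>
      have "orbit (?conj \<rho> \<circ> two_cycles N (N - a)) (?h x)
          = ?h ` orbit (\<rho> \<circ> two_cycles N a) x" for x
        using assms
        by (intro orbit_semiconj) (simp add: swap_blocks_two_cycles[symmetric] h'h)
      then have "orbit (?conj \<rho> \<circ> two_cycles N (N - a)) ` ?h ` {1..N}
          = (`) ?h ` orbit (\<rho> \<circ> two_cycles N a) ` {1..N}"
        by (simp add: image_image)
      then have "orbit (?conj \<rho> \<circ> two_cycles N (N - a)) ` {1..N}
          = (`) ?h ` orbit (\<rho> \<circ> two_cycles N a) ` {1..N}"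
        by (simp only: permutes_image[OF perms(1)])
      moreover have "inj_on ((`) ?h) X" for X
        using permutes_inj[OF perms(1)] by (auto intro!: inj_onI simp: inj_image_eq_iff)
      ultimately show ?thesis by (simp add: card_image)
    qed
    ultimately show "?conj \<rho> \<in> long_cycle_factors N (N - a) m"
      using m by (simp add: long_cycle_factors_def)
  qed
qed (rule finite_long_cycle_factors)

lemma card_long_cycle_factors_sym:
  assumes "1 \<le> a" and "a < N"
  shows "card (long_cycle_factors N a m) = card (long_cycle_factors N (N - a) m)"
  using card_long_cycle_factors_le[of a N m] card_long_cycle_factors_le[of "N - a" N m] assms
  by simp

section \<open>Dipoles\<close>

lemma cycle_of_list_nth:
  assumes "distinct cs" and "i < length cs"
  shows "cycle_of_list cs (cs ! i) = cs ! (Suc i mod length cs)"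
proof -
  have "map (cycle_of_list cs) cs = rotate1 cs"
    using cyclic_rotation[OF assms(1), of 1] by simp
  then have "map (cycle_of_list cs) cs ! i = rotate1 cs ! i" by simp
  with assms(2) show ?thesis by (simp add: nth_rotate1)
qed

context
  fixes n q :: nat
  assumes n: "3 \<le> n" and q: "2 \<le> q" "q \<le> n - 1"
begin

lemma root_rotation_permutes: "root_rotation n q permutes {1..n}"
proof -
  have "set ([n] @ [1..<q] @ [n - 1] @ [q..<n - 1]) = {1..n}"
    using n q by auto
  then show ?thesis
    unfolding root_rotation_def by (metis cycle_permutes)
qed

lemma root_rotation_root: "root_rotation n q n = 1"
  and root_rotation_less:
    "1 \<le> x \<Longrightarrow> x < n - 1 \<Longrightarrow>
      root_rotation n q x = (if x = q - 1 then n - 1 else if x = n - 2 then n else x + 1)"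
  and root_rotation_distinguished:
    "root_rotation n q (n - 1) = (if q = n - 1 then n else q)"
proof -
  define L where "L = [n] @ [1..<q] @ [n - 1] @ [q..<n - 1]"
  have len: "length L = n" and dist: "distinct L"
    using n q by (auto simp: L_def)
  have nth: "L ! i = (if i = 0 then n else if i < q then i else if i = q then n - 1 else i - 1)"
    if "i < n" for i
    using that n q by (auto simp: L_def nth_append nth_Cons' simp del: upt_Suc)
  have L: "root_rotation n q = cycle_of_list L"
    by (simp only: root_rotation_def L_def)
  have C: "root_rotation n q (L ! i) = L ! (Suc i mod n)" if "i < n" for i
    using cycle_of_list_nth[OF dist, of i] that len by (simp add: L)
  show "root_rotation n q n = 1"
    using C[of 0] n q by (simp add: nth)
  show "root_rotation n q (n - 1) = (if q = n - 1 then n else q)"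
    using C[of q] n q by (auto simp: nth)
  show "root_rotation n q x = (if x = q - 1 then n - 1 else if x = n - 2 then n else x + 1)"
    if "1 \<le> x" "x < n - 1"
  \<comment> \<open>The letter x stands at index x if x < q and at index x + 1 otherwise. In the
    second case x = n - 2 is the last entry, and its successor wraps around to n.\<close>
  proof (cases "x < q")
    case True
    then show ?thesis
      using C[of x] n q that by (auto simp: nth)
  next
    case False
    then show ?thesis
      using C[of "x + 1"] n q that by (cases "x + 2 = n") (auto simp: nth)
  qed
qed

text \<open>\<open>E\<close> is (n 1 ... q-1)(q ... n-1), and erasing n leaves (1 ... q-1)(q ...
  n-1). By \<open>2 \<le> q\<close> the letter n is not a fixed point of \<open>E\<close>.\<close>

lemma two_cycles_eq_erase:
  assumes "x \<in> {1..n - 1}"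
  defines "E \<equiv> transpose (n - 1) n \<circ> root_rotation n q"
  shows "two_cycles (n - 1) (q - 1) x = (if E x = n then E n else E x)"
proof -
  consider "x = n - 1" | "1 \<le> x" "x < n - 1"
    using assms(1) by fastforce
  then show ?thesis
  proof cases
    case 1
    then show ?thesis
      using n q
      by (auto simp: E_def two_cycles_def root_rotation_root transpose_def
          root_rotation_distinguished[unfolded One_nat_def])
  next
    case 2
    moreover have "Suc (n - 2) = n - 1"
      using n by simp
    ultimately show ?thesis
      using n q
      by (auto simp: E_def two_cycles_def root_rotation_root root_rotation_less transpose_def)
  qed
qed

text \<open>The letter n is erased twice: from \<sigma>, to compare cyclicity, and from the product,
  to compare the numbers of cycles.\<close>

lemma dipole_perms_iff_long_cycle_factors:
  assumes \<sigma>: "\<sigma> permutes {1..n}" and "\<sigma> (n - 1) = n"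
  shows "\<sigma> \<in> dipole_perms n q g \<longleftrightarrow>
    \<sigma> \<circ> transpose (n - 1) n \<in> long_cycle_factors (n - 1) (q - 1) (int n - 2 * int g)"
proof -
  define \<tau> where "\<tau> = transpose (n - 1) n"
  define \<rho> where "\<rho> = \<sigma> \<circ> \<tau>"
  define E where "E = \<tau> \<circ> root_rotation n q"
  have ins: "insert n {1..n - 1} = {1..n}" and notin: "n \<notin> {1..n - 1}"
    using n by auto
  have inj: "\<sigma> x = \<sigma> y \<longleftrightarrow> x = y" for x y
    using permutes_inj[OF \<sigma>] by (auto dest: injD)
  have \<tau>: "\<tau> permutes {1..n}"
    unfolding \<tau>_def using n by (intro permutes_swap_id) auto
  have \<rho>n: "\<rho> n = n"
    using assms(2) by (simp add: \<rho>_def \<tau>_def)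
  have \<rho>_iff: "\<rho> x = n \<longleftrightarrow> x = n" for x
    using permutes_inj[OF permutes_compose[OF \<tau> \<sigma>]] \<rho>n by (metis \<rho>_def injD)
  have perm: "\<rho> permutes {1..n - 1}"
    using permutes_compose[OF \<tau> \<sigma>] unfolding \<rho>_def[symmetric]
    by (rule permutes_superset) (metis Diff_iff \<rho>n ins insertE)
  have "\<sigma> n \<noteq> n"
    using inj[of n "n - 1"] assms(2) n by auto
  \<comment> \<open>On 1..n-1, \<rho> differs from \<sigma> only at n - 1, which it sends to
    \<open>\<sigma> n\<close>: this is \<sigma> with n erased.\<close>
  then have cyc: "cyclic_on \<rho> {1..n - 1} \<longleftrightarrow> cyclic_on \<sigma> {1..n}"
    using n assms(2) inj[of _ "n - 1"] \<sigma> notin unfolding ins[symmetric]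
    by (intro cyclic_on_erase_iff) (auto simp: \<rho>_def \<tau>_def transpose_def)
  have "\<tau> (\<tau> x) = x" for x
    by (simp add: \<tau>_def)
  then have prod: "\<sigma> \<circ> root_rotation n q = \<rho> \<circ> E"
    by (simp add: \<rho>_def E_def fun_eq_iff)
  have En: "E n = 1"
    using n by (simp add: E_def \<tau>_def root_rotation_root transpose_def)
  \<comment> \<open>As \<rho> fixes n, erasing n from \<open>\<rho> \<circ> E\<close> is the same as
    erasing it from \<open>E\<close> and then applying \<rho>.\<close>
  have "card (orbit (\<rho> \<circ> two_cycles (n - 1) (q - 1)) ` {1..n - 1})
      = card (orbit (\<rho> \<circ> E) ` insert n {1..n - 1})"
  proof (rule card_orbits_erase)
    show "(\<rho> \<circ> two_cycles (n - 1) (q - 1)) x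
        = (if (\<rho> \<circ> E) x = n then (\<rho> \<circ> E) n else (\<rho> \<circ> E) x)" if "x \<in> {1..n - 1}" for x
      using two_cycles_eq_erase[OF that] by (simp add: E_def \<tau>_def \<rho>_iff)
    show "\<rho> \<circ> E permutes insert n {1..n - 1}"
      unfolding ins prod[symmetric] using root_rotation_permutes \<sigma> by (rule permutes_compose)
    show "(\<rho> \<circ> E) n \<noteq> n"
      using n by (simp add: \<rho>_iff En)
  qed (use notin in auto)
  then have "card (orbit (\<rho> \<circ> two_cycles (n - 1) (q - 1)) ` {1..n - 1})
      = num_cycles n (\<sigma> \<circ> root_rotation n q)"
    by (simp only: num_cycles_def prod ins)
  moreover have "inv \<sigma> n = n - 1"
    using assms permutes_inv_eq by metis
  ultimately show ?thesis
    using \<sigma> perm cyc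
    by (simp add: dipole_perms_def long_cycle_factors_def \<rho>_def \<tau>_def)
qed

text \<open>Right multiplication by the transposition is an involution, so the preceding equivalence
  yields both directions of a bijection.\<close>

lemma num_dipoles_eq_card_long_cycle_factors:
  "num_dipoles n q g = card (long_cycle_factors (n - 1) (q - 1) (int n - 2 * int g))"
proof -
  let ?\<tau> = "transpose (n - 1) n"
  let ?F = "long_cycle_factors (n - 1) (q - 1) (int n - 2 * int g)"
  have invol: "(f \<circ> ?\<tau>) \<circ> ?\<tau> = f" for f :: "nat \<Rightarrow> nat"
    by (simp add: fun_eq_iff)
  have "\<sigma> \<circ> ?\<tau> \<in> ?F" if "\<sigma> \<in> dipole_perms n q g" for \<sigma>
  proof -
    from that have "\<sigma> permutes {1..n}" "\<sigma> (n - 1) = n"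
      using permutes_inv_eq by (fastforce simp: dipole_perms_def)+
    with that show ?thesis
      by (simp add: dipole_perms_iff_long_cycle_factors)
  qed
  moreover have "\<rho> \<circ> ?\<tau> \<in> dipole_perms n q g" if "\<rho> \<in> ?F" for \<rho>
  proof -
    have \<rho>: "\<rho> permutes {1..n - 1}"
      using that by (simp add: long_cycle_factors_def)
    then have "\<rho> permutes {1..n}"
      by (rule permutes_subset) auto
    moreover have "?\<tau> permutes {1..n}"
      using n by (intro permutes_swap_id) auto
    ultimately have "\<rho> \<circ> ?\<tau> permutes {1..n}"
      by (intro permutes_compose)
    moreover have "(\<rho> \<circ> ?\<tau>) (n - 1) = n"
      using n permutes_not_in[OF \<rho>, of n] by simp
    ultimately show ?thesis
      using that by (simp only: dipole_perms_iff_long_cycle_factors invol)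
  qed
  ultimately have "bij_betw (\<lambda>f. f \<circ> ?\<tau>) (dipole_perms n q g) ?F"
    by (intro bij_betw_byWitness[where f' = "\<lambda>f. f \<circ> ?\<tau>"]) (auto simp: invol)
  then show ?thesis
    by (simp add: num_dipoles_def bij_betw_same_card)
qed

end

theorem mainTheorem10:
  fixes n p p' :: nat
  assumes "n \<ge> 3"
    and "2 \<le> p" and "p \<le> n - 1"
    and "p + p' = n + 1"
  shows "\<forall>g. num_dipoles n p g = num_dipoles n p' g"
proof
  fix g
  \<comment> \<open>The block sizes p - 1 and p' - 1 add up to n - 1, so passing from p to p'
    exchanges the two blocks.\<close>
  have p': "2 \<le> p'" "p' \<le> n - 1" "p' - 1 = (n - 1) - (p - 1)"
    using assms by auto
  show "num_dipoles n p g = num_dipoles n p' g"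
    using assms p' card_long_cycle_factors_sym[of "p - 1" "n - 1" "int n - 2 * int g"]
    by (simp add: num_dipoles_eq_card_long_cycle_factors)
qed

end
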